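(* Let $D \ge 1$ and $\lambda \ge 0$. Let $k_\infty : \mathbb{R}^D \times \mathbb{R}^D \to \mathbb{R}$ be the Mondrian kernel of order $\infty$ with lifetime $\lambda$, i.e. $k_\infty(\mathbf{x},\mathbf{x}') = \mathbb{E}[k_1(\mathbf{x},\mathbf{x}')]$, where $k_1(\mathbf{x},\mathbf{x}')$ is the indicator that $\mathbf{x}$ and $\mathbf{x}'$ lie in the same cell of the random partition of $\mathbb{R}^D$ generated by a Mondrian process on $\mathbb{R}^D$ with lifetime $\lambda$. Then $k_\infty$ coincides with the Laplace kernel of lifetime $\lambda$: for all $\mathbf{x}, \mathbf{x}' \in \mathbb{R}^D$, $$k_\infty(\mathbf{x},\mathbf{x}') = \exp\left(-\lambda \|\mathbf{x}-\mathbf{x}'\|_1\right) = \exp\left(-\lambda \sum_{d=1}^D |x_d - x'_d|\right).$$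
   Context: An axis-aligned box $\mathcal{X} = \mathcal{X}_1 \times \cdots \times \mathcal{X}_D \subseteq \mathbb{R}^D$ is a product of bounded intervals; $|\mathcal{X}_d|$ is the length of $\mathcal{X}_d$. $\mathrm{Exp}(r)$ is the exponential distribution with rate $r$ (with rate $0$ meaning the value $+\infty$ almost surely). Mondrian process on a box $\mathcal{X}$: a time-indexed stochastic process with values in hierarchical axis-aligned (guillotine) partitions of $\mathcal{X}$. It starts at time $0$ with the trivial partition $\{\mathcal{X}\}$. Independent exponential clocks with rates $|\mathcal{X}_1|,\ldots,|\mathcal{X}_D|$ are started, one per dimension. Let $T$ be the first time a clock rings and $d$ the dimension of that clock. At time $T$, a point $a$ is chosen uniformly at random from $\mathcal{X}_d$ and $\mathcal{X}$ is split into $\{\mathbf{x} \in \mathcal{X} : x_d < a\}$ and $\{\mathbf{x} \in \mathcal{X} : x_d \ge a\}$. The remaining clocks are discarded and the same procedure restarts, from time $T$, independently on each of the two sub-boxes, with fresh clocks whose rates are the side lengths of the sub-box, and so on recursively. The Mondrian process with lifetime $\lambda \in [0,\infty)$ is obtained by ignoring all cuts that would appear after time $\lambda$; the partition it generates is the partition at time $\lambda$. The Mondrian process on $\mathbb{R}^D$ is a time-indexed stochastic process with values in partitions of $\mathbb{R}^D$ such that its restriction to any axis-aligned box $\mathcal{X} \subseteq \mathbb{R}^D$ is a Mondrian process on $\mathcal{X}$ as just defined. *)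

theory Defs
  imports "HOL-Probability.Probability"
begin

section \<open>Axis-aligned boxes\<close>

definition axis_box :: "(real ^ 'n) set \<Rightarrow> bool" where
  "axis_box X \<longleftrightarrow> X \<noteq> {} \<and>
     (\<exists>I. (\<forall>d. is_interval (I d) \<and> bounded (I d)) \<and> X = {x. \<forall>d. x $ d \<in> I d})"

definition side :: "'n \<Rightarrow> (real ^ 'n) set \<Rightarrow> real set" where
  "side d C = (\<lambda>x. x $ d) ` C"

definition side_length :: "'n \<Rightarrow> (real ^ 'n) set \<Rightarrow> real" where
  "side_length d C = Sup (side d C) - Inf (side d C)"


section \<open>The Mondrian process on a box\<close>

text \<open>
  The randomness is attached to the nodes of the infinite binary tree of sub-boxes. A node is
  given by the left/right choices leading to it, the most recent one first (\<^term>\<open>True\<close> is the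
  side \<open>x\<^sub>d \<ge> a\<close>). Independently for every node, the noise consists of one standard
  exponential variable per dimension and of one uniform variable on the unit interval, all
  independent. A clock of rate \<open>r\<close> is obtained by dividing a standard exponential variable by \<open>r\<close>,
  and a uniform point of an interval by an affine map; see the lemmas
  \<open>distr_exponential_clock\<close> and \<open>distr_cut_point\<close> below.
\<close>

type_synonym 'n noise = "bool list \<Rightarrow> ('n \<Rightarrow> real) \<times> real"

definition node_noise :: "(('n::finite \<Rightarrow> real) \<times> real) measure" where
  "node_noise =
     (\<Pi>\<^sub>M d\<in>UNIV. density lborel (exponential_density 1)) \<Otimes>\<^sub>M uniform_measure lborel {0..1}"

definition noise_space :: "'n::finite noise measure" where
  "noise_space = (\<Pi>\<^sub>M \<nu>\<in>UNIV. node_noise)"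

definition exp_clock :: "real \<Rightarrow> real \<Rightarrow> ereal" where
  "exp_clock r e = (if r = 0 then \<infinity> else ereal (e / r))"

definition clock :: "(real ^ 'n) set \<Rightarrow> ('n \<Rightarrow> real) \<times> real \<Rightarrow> 'n \<Rightarrow> ereal" where
  "clock C z d = exp_clock (side_length d C) (fst z d)"

text \<open>The time, counted from the creation of the box \<open>C\<close>, at which \<open>C\<close> is cut.\<close>

definition ring_time :: "(real ^ 'n) set \<Rightarrow> ('n \<Rightarrow> real) \<times> real \<Rightarrow> ereal" where
  "ring_time C z = (INF d. clock C z d)"

definition cut_dim :: "(real ^ 'n) set \<Rightarrow> ('n \<Rightarrow> real) \<times> real \<Rightarrow> 'n" where
  "cut_dim C z = (ARG_MIN (clock C z) d. True)"

definition cut_point :: "(real ^ 'n) set \<Rightarrow> ('n \<Rightarrow> real) \<times> real \<Rightarrow> real" where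
  "cut_point C z =
     Inf (side (cut_dim C z) C) + side_length (cut_dim C z) C * snd z"

definition child :: "bool \<Rightarrow> (real ^ 'n) set \<Rightarrow> ('n \<Rightarrow> real) \<times> real \<Rightarrow> (real ^ 'n) set" where
  "child b C z =
     (if b then {x \<in> C. x $ cut_dim C z \<ge> cut_point C z}
      else {x \<in> C. x $ cut_dim C z < cut_point C z})"

primrec cell :: "(real ^ 'n) set \<Rightarrow> 'n noise \<Rightarrow> bool list \<Rightarrow> (real ^ 'n) set" where
  "cell X \<omega> [] = X"
| "cell X \<omega> (b # \<nu>) = child b (cell X \<omega> \<nu>) (\<omega> \<nu>)"

text \<open>
  If no clock of a box ever rings, then its two children are born at time \<open>\<infinity>\<close>, hence never appear.
\<close>

primrec birth :: "(real ^ 'n) set \<Rightarrow> 'n noise \<Rightarrow> bool list \<Rightarrow> ereal" where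
  "birth X \<omega> [] = 0"
| "birth X \<omega> (b # \<nu>) = birth X \<omega> \<nu> + ring_time (cell X \<omega> \<nu>) (\<omega> \<nu>)"

text \<open>
  The partition at time \<open>t\<close> consists of the boxes which have been created, but not yet been cut,
  at time \<open>t\<close>. Empty boxes arise only if a cut point hits the boundary of a side (a null event).
\<close>

definition box_mondrian :: "(real ^ 'n) set \<Rightarrow> real \<Rightarrow> 'n noise \<Rightarrow> (real ^ 'n) set set" where
  "box_mondrian X t \<omega> =
     {cell X \<omega> \<nu> | \<nu>. birth X \<omega> \<nu> \<le> ereal t \<and>
        ereal t < birth X \<omega> \<nu> + ring_time (cell X \<omega> \<nu>) (\<omega> \<nu>)} - {{}}"


section \<open>Random partitions and their laws\<close>

definition same_cell :: "'a set set \<Rightarrow> 'a \<Rightarrow> 'a \<Rightarrow> bool" where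
  "same_cell P x y \<longleftrightarrow> (\<exists>C\<in>P. x \<in> C \<and> y \<in> C)"

text \<open>
  Partitions of \<open>X\<close> carry the \<open>\<sigma>\<close>-algebra generated by the events that two given points lie in the
  same cell, and trajectories the product \<open>\<sigma>\<close>-algebra over the times \<open>t \<ge> 0\<close>. The underlying space is
  not restricted to the partitions of \<open>X\<close>, because on the null event that infinitely many cuts
  occur in finite time \<^const>\<open>box_mondrian\<close> need not cover \<open>X\<close>.
\<close>

definition partition_space :: "'a set \<Rightarrow> 'a set set measure" where
  "partition_space X = sigma UNIV {{P. same_cell P x y} | x y. x \<in> X \<and> y \<in> X}"

definition path_space :: "'a set \<Rightarrow> (real \<Rightarrow> 'a set set) measure" where
  "path_space X = (\<Pi>\<^sub>M t\<in>{0..}. partition_space X)"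

definition trajectory :: "(real \<Rightarrow> 'w \<Rightarrow> 'b) \<Rightarrow> 'w \<Rightarrow> real \<Rightarrow> 'b" where
  "trajectory Y \<omega> = (\<lambda>t\<in>{0..}. Y t \<omega>)"

definition mondrian_process_on_box ::
  "'w measure \<Rightarrow> (real \<Rightarrow> 'w \<Rightarrow> (real ^ 'n::finite) set set) \<Rightarrow> (real ^ 'n) set \<Rightarrow> bool" where
  "mondrian_process_on_box M Y X \<longleftrightarrow>
     prob_space M \<and>
     (\<forall>t\<ge>0. \<forall>\<omega>\<in>space M. partition_on X (Y t \<omega>)) \<and>
     trajectory Y \<in> measurable M (path_space X) \<and>
     distr M (path_space X) (trajectory Y) =
       distr noise_space (path_space X) (trajectory (box_mondrian X))"

definition restrict_partition :: "'a set \<Rightarrow> 'a set set \<Rightarrow> 'a set set" where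
  "restrict_partition X P = (\<lambda>C. C \<inter> X) ` P - {{}}"

definition mondrian_process ::
  "'w measure \<Rightarrow> (real \<Rightarrow> 'w \<Rightarrow> (real ^ 'n::finite) set set) \<Rightarrow> bool" where
  "mondrian_process M Y \<longleftrightarrow>
     prob_space M \<and>
     (\<forall>t\<ge>0. \<forall>\<omega>\<in>space M. partition_on UNIV (Y t \<omega>)) \<and>
     (\<forall>X. axis_box X \<longrightarrow> mondrian_process_on_box M (\<lambda>t \<omega>. restrict_partition X (Y t \<omega>)) X)"


section \<open>Kernels\<close>

definition mondrian_kernel_1 :: "(real ^ 'n) set set \<Rightarrow> real ^ 'n \<Rightarrow> real ^ 'n \<Rightarrow> real" where
  "mondrian_kernel_1 P x x' = of_bool (same_cell P x x')"

definition mondrian_kernel_inf ::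
  "'w measure \<Rightarrow> (real \<Rightarrow> 'w \<Rightarrow> (real ^ 'n) set set) \<Rightarrow> real \<Rightarrow> real ^ 'n \<Rightarrow> real ^ 'n \<Rightarrow> real" where
  "mondrian_kernel_inf M Y lam x x' = (\<integral>\<omega>. mondrian_kernel_1 (Y lam \<omega>) x x' \<partial>M)"

definition l1_norm :: "real ^ 'n \<Rightarrow> real" where
  "l1_norm v = (\<Sum>d\<in>UNIV. \<bar>v $ d\<bar>)"

definition laplace_kernel :: "real \<Rightarrow> real ^ 'n \<Rightarrow> real ^ 'n \<Rightarrow> real" where
  "laplace_kernel lam x x' = exp (- lam * l1_norm (x - x'))"


section \<open>The laws of clocks and cut points\<close>

lemma distr_exponential_clock:
  assumes "0 < r"
  shows "distr (density lborel (exponential_density 1)) borel (\<lambda>e. e / r)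
       = density lborel (exponential_density r)"
proof -
  let ?E = "density lborel (exponential_density 1)"
  interpret prob_space ?E
    by (rule prob_space_exponential_density) simp
  have "distributed ?E lborel (\<lambda>x. x) (exponential_density 1)"
    by (simp add: distributed_def distr_id2)
  from distributed_affine[OF this, of "1 / r" 0] assms
  have "distributed ?E lborel (\<lambda>x. x / r)
          (\<lambda>x. ennreal (exponential_density 1 (x * r)) / ennreal (1 / r))"
    by simp
  then have "distr ?E lborel (\<lambda>x. x / r)
      = density lborel (\<lambda>x. ennreal (exponential_density 1 (x * r)) / ennreal (1 / r))"
    by (simp add: distributed_def)
  also have "\<dots> = density lborel (exponential_density r)"
    using assms
    by (intro density_cong)
       (auto simp: exponential_density_def divide_ennreal zero_le_mult_iff mult_less_0_iff field_simps)
  finally show ?thesis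
    by (simp cong: distr_cong)
qed

lemma distr_cut_point:
  fixes a b :: real
  assumes "a < b"
  shows "distr (uniform_measure lborel {0..1}) borel (\<lambda>u. a + (b - a) * u)
       = uniform_measure lborel {a..b}"
proof (rule measure_eqI)
  fix A
  assume "A \<in> sets (distr (uniform_measure lborel {0..1}) borel (\<lambda>u. a + (b - a) * u))"
  then have [measurable]: "A \<in> sets borel" by simp
  have *: "(\<lambda>u. a + (b - a) * u) -` (A \<inter> {a..b}) = {0..1} \<inter> (\<lambda>u. a + (b - a) * u) -` A"
  proof -
    have "a + (b - a) * u \<le> b \<longleftrightarrow> u \<le> 1" for u
      using mult_le_cancel_left_pos[of "b - a" u 1] assms by (simp only: mult_1_right) linarith
    then show ?thesis
      using assms by (auto simp: zero_le_mult_iff)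
  qed
  have "emeasure lborel (A \<inter> {a..b})
      = ennreal (b - a) * emeasure lborel ({0..1} \<inter> (\<lambda>u. a + (b - a) * u) -` A)"
    using assms
    by (subst lborel_real_affine[of "b - a" a])
       (simp_all add: emeasure_density nn_integral_cmult_indicator emeasure_distr nn_integral_distr
          nn_integral_cmult indicator_vimage[symmetric] * [symmetric] flip: vimage_Int)
  moreover have "(\<lambda>u. a + (b - a) * u) -` A \<in> sets lborel"
    using measurable_sets_borel[of "\<lambda>u. a + (b - a) * u" borel A] by simp
  moreover have "ennreal (b - a) * c / ennreal (b - a) = c" for c
    using assms by (simp add: mult.commute[of "ennreal (b - a)"] ennreal_mult_divide_eq)
  moreover have "c / 1 = c" for c :: ennreal
    by (simp add: divide_ennreal_def)
  ultimately show "emeasure (distr (uniform_measure lborel {0..1}) borel (\<lambda>u. a + (b - a) * u)) A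
      = emeasure (uniform_measure lborel {a..b}) A"
    using assms
    by (simp add: emeasure_distr Int_commute[of A] emeasure_uniform_measure)
qed simp

lemma prob_space_noise_space: "prob_space (noise_space :: 'n::finite noise measure)"
proof -
  let ?E = "density lborel (exponential_density 1)"
  have "prob_space ?E"
    by (rule prob_space_exponential_density) simp
  then have 1: "prob_space (\<Pi>\<^sub>M d\<in>(UNIV :: 'n set). ?E)"
    by (intro prob_space_PiM)
  have 2: "prob_space (uniform_measure lborel {0..1::real})"
    by (rule prob_space_uniform_measure) simp_all
  have "prob_space (node_noise :: (('n \<Rightarrow> real) \<times> real) measure)"
    unfolding node_noise_def using 1 2 by (rule prob_space_pair)
  then show ?thesis
    unfolding noise_space_def by (intro prob_space_PiM)
qed

end

theory Submission
  imports Defs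
begin

text \<open>
  Restrict the process to the smallest closed box containing \<open>x\<close> and \<open>x'\<close>. They are opposite corners
  of that box, so almost surely its very first cut separates them. Hence they share a cell at
  time \<open>\<lambda>\<close> exactly when no clock of the box rings before \<open>\<lambda>\<close>, and the clocks are independent
  exponential variables with rates \<open>\<bar>x\<^sub>d - x'\<^sub>d\<bar>\<close>.
\<close>

text \<open>
  The events of a non-measurable map get emeasure 0, and so do their complements, which is
  impossible if the image is a probability measure.
\<close>

lemma measurable_if_prob_space_distr:
  assumes "prob_space (distr M N f)" and f: "f \<in> space M \<rightarrow> space N"
  shows "f \<in> measurable M N"
proof (rule measurableI)
  interpret D: prob_space "distr M N f" by fact
  fix A assume A: "A \<in> sets N"
  show "f -` A \<inter> space M \<in> sets M"
  proof (rule ccontr)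
    assume nm: "f -` A \<inter> space M \<notin> sets M"
    \<comment> \<open>\<open>distr\<close> is built by \<open>measure_of\<close>. If the set
      function it receives is a measure, the value is \<open>emeasure M\<close> of a set outside
      \<open>sets M\<close>, hence 0; otherwise 0 is the default.\<close>
    have zero: "emeasure (distr M N f) B = 0" if "f -` B \<inter> space M \<notin> sets M" for B
      using that by (simp add: distr_def emeasure_measure_of_conv emeasure_notin_sets)
    have "f -` (space N - A) \<inter> space M = space M - (f -` A \<inter> space M)"
      using f by auto
    moreover have "space M - (f -` A \<inter> space M) \<notin> sets M"
    proof
      assume "space M - (f -` A \<inter> space M) \<in> sets M"
      then have "space M - (space M - (f -` A \<inter> space M)) \<in> sets M" by blast
      moreover have "space M - (space M - (f -` A \<inter> space M)) = f -` A \<inter> space M" by blast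
      ultimately show False using nm by simp
    qed
    ultimately have "emeasure (distr M N f) (space N - A) = 0" by (simp add: zero)
    moreover have "emeasure (distr M N f) A = 0" using nm by (rule zero)
    moreover have "emeasure (distr M N f) (space N)
        = emeasure (distr M N f) A + emeasure (distr M N f) (space N - A)"
      using A sets.sets_into_space[OF A]
      by (subst plus_emeasure) (auto intro: arg_cong[where f = "emeasure (distr M N f)"])
    ultimately show False using D.emeasure_space_1 by simp
  qed
qed (use f in auto)

section \<open>The box spanned by two points and its first cut\<close>

definition bounding_box :: "real ^ 'n \<Rightarrow> real ^ 'n \<Rightarrow> (real ^ 'n) set" where
  "bounding_box x y = {z. \<forall>d. z $ d \<in> {min (x $ d) (y $ d)..max (x $ d) (y $ d)}}"

lemma mem_bounding_box [simp]: "x \<in> bounding_box x y" "y \<in> bounding_box x y"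
  by (auto simp: bounding_box_def)

lemma axis_box_bounding_box: "axis_box (bounding_box x y)"
proof -
  have "bounding_box x y \<noteq> {}" using mem_bounding_box(1) by blast
  then show ?thesis
    unfolding axis_box_def
    by (intro conjI exI[of _ "\<lambda>d. {min (x $ d) (y $ d)..max (x $ d) (y $ d)}"])
       (simp_all add: bounding_box_def is_interval_cc)
qed

lemma side_bounding_box:
  "side d (bounding_box x y) = {min (x $ d) (y $ d)..max (x $ d) (y $ d)}"
proof (intro set_eqI iffI)
  fix s assume "s \<in> {min (x $ d) (y $ d)..max (x $ d) (y $ d)}"
  then have "(\<chi> i. if i = d then s else x $ i) \<in> bounding_box x y"
    by (auto simp: bounding_box_def)
  then show "s \<in> side d (bounding_box x y)"
    unfolding side_def by (rule rev_image_eqI) simp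
qed (auto simp: side_def bounding_box_def)

lemma Inf_side_bounding_box: "Inf (side d (bounding_box x y)) = min (x $ d) (y $ d)"
  by (simp add: side_bounding_box)

lemma side_length_bounding_box: "side_length d (bounding_box x y) = \<bar>x $ d - y $ d\<bar>"
  by (simp add: side_length_def side_bounding_box)

text \<open>There are finitely many dimensions, so a smallest clock exists and
  \<open>ARG_MIN\<close> really selects a minimiser.\<close>

lemma clock_cut_dim: "clock C z (cut_dim C z) = ring_time C (z :: ('n::finite \<Rightarrow> real) \<times> real)"
proof -
  have "is_arg_min (clock C z) (\<lambda>d. d \<in> UNIV) (cut_dim C z)"
    unfolding cut_dim_def arg_min_def using ex_is_arg_min_if_finite[of UNIV "clock C z"]
    by (auto intro: someI_ex)
  then show ?thesis
    unfolding ring_time_def is_arg_min_linorder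
    by (intro antisym INF_greatest INF_lower) auto
qed

text \<open>Since the infimum of the clocks is attained, the strict inequality carries over from all
  clocks to it. A zero side gives an infinite clock and imposes no condition.\<close>

lemma less_ring_time_iff:
  "ereal t < ring_time C z \<longleftrightarrow>
     (\<forall>d::'n::finite. side_length d C = 0 \<or> ereal t < ereal (fst z d / side_length d C))"
proof -
  have "ereal t < ring_time C z \<longleftrightarrow> (\<forall>d. ereal t < clock C z d)"
  proof
    show "\<forall>d. ereal t < clock C z d" if "ereal t < ring_time C z"
      using that unfolding ring_time_def by (meson INF_lower UNIV_I less_le_trans)
    show "ereal t < ring_time C z" if "\<forall>d. ereal t < clock C z d"
      using that by (metis clock_cut_dim)
  qed
  also have "\<dots> \<longleftrightarrow>
      (\<forall>d. side_length d C = 0 \<or> ereal t < ereal (fst z d / side_length d C))"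
    by (intro all_cong1) (simp add: clock_def exp_clock_def)
  finally show ?thesis .
qed

text \<open>Nodes list the most recent choice first, so the last entry \<open>b\<close> records the
  very first cut; every later cut only shrinks the cell.\<close>

lemma cell_append_subset: "cell X \<omega> (\<nu> @ [b]) \<subseteq> child b X (\<omega> [])"
  by (induction \<nu>) (auto simp: child_def)

text \<open>In the dimension that is cut, the two points sit at the two ends of the side, and the
  cut point lies in the half-open interval from the lower end (excluded) to the upper end
  (included). So the lower point goes left and the upper one right. The value
  \<open>snd z = 0\<close> would put both into the right child, whereas \<open>snd z = 1\<close> is
  harmless because that child contains its boundary.\<close>

lemma first_cut_separates:
  fixes x y :: "real ^ 'n::finite"
  assumes u: "0 < snd z" "snd z \<le> 1"
    and T: "ring_time (bounding_box x y) z \<noteq> \<infinity>"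
  shows "\<not> (x \<in> child b (bounding_box x y) z \<and> y \<in> child b (bounding_box x y) z)"
proof -
  define d where "d = cut_dim (bounding_box x y) z"
  define r where "r = \<bar>x $ d - y $ d\<bar>"
  have "clock (bounding_box x y) z d \<noteq> \<infinity>"
    using T by (simp add: d_def clock_cut_dim)
  \<comment> \<open>Coordinates in which the points agree have rate 0 and never ring, so a finite
    ring time comes from a side of positive length.\<close>
  then have "r \<noteq> 0"
    by (auto simp: clock_def exp_clock_def side_length_bounding_box r_def)
  then have r: "r > 0" by (simp add: r_def)
  have cp: "cut_point (bounding_box x y) z = min (x $ d) (y $ d) + r * snd z"
    by (simp add: cut_point_def Inf_side_bounding_box side_length_bounding_box d_def r_def)
  have "0 < r * snd z" "r * snd z \<le> r"
    using r u by (simp_all add: mult_left_le)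
  then have "min (x $ d) (y $ d) < cut_point (bounding_box x y) z"
      "cut_point (bounding_box x y) z \<le> max (x $ d) (y $ d)"
    unfolding cp by (auto simp: r_def)
  then show ?thesis
    by (auto simp: child_def d_def[symmetric] min_def max_def split: if_splits)
qed

lemma same_cell_bounding_box_iff:
  fixes x y :: "real ^ 'n::finite"
  assumes u: "0 < snd (\<omega> [])" "snd (\<omega> []) \<le> 1" and t: "0 \<le> t"
  shows "same_cell (box_mondrian (bounding_box x y) t \<omega>) x y \<longleftrightarrow>
           ereal t < ring_time (bounding_box x y) (\<omega> [])"
proof
  let ?X = "bounding_box x y"
  assume "ereal t < ring_time ?X (\<omega> [])"
  moreover have "?X \<noteq> {}" using mem_bounding_box(1) by blast
  ultimately have "?X \<in> box_mondrian ?X t \<omega>"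
    using t unfolding box_mondrian_def
    by (intro DiffI CollectI exI[of _ "[]"]) auto
  then show "same_cell (box_mondrian ?X t \<omega>) x y"
    unfolding same_cell_def using mem_bounding_box by blast
next
  let ?X = "bounding_box x y"
  assume "same_cell (box_mondrian ?X t \<omega>) x y"
  then obtain \<nu> where \<nu>: "x \<in> cell ?X \<omega> \<nu>" "y \<in> cell ?X \<omega> \<nu>"
      "ereal t < birth ?X \<omega> \<nu> + ring_time (cell ?X \<omega> \<nu>) (\<omega> \<nu>)"
    by (auto simp: same_cell_def box_mondrian_def)
  show "ereal t < ring_time ?X (\<omega> [])"
  \<comment> \<open>Splitting at the end of the list isolates the first cut. If there was one, two
    points in a common child force the ring time to be infinite, which exceeds \<open>t\<close> as
    well.\<close>
  proof (cases \<nu> rule: rev_cases)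
    case Nil
    then show ?thesis using \<nu> by simp
  next
    case (snoc \<mu> b)
    then have "x \<in> child b ?X (\<omega> [])" "y \<in> child b ?X (\<omega> [])"
      using \<nu> cell_append_subset by blast+
    with first_cut_separates[OF u] have "ring_time ?X (\<omega> []) = \<infinity>" by blast
    then show ?thesis by simp
  qed
qed

section \<open>Probabilities under the noise\<close>

lemma prob_space_std_exponential: "prob_space (density lborel (exponential_density 1))"
  by (rule prob_space_exponential_density) simp

lemma prob_space_unit_uniform: "prob_space (uniform_measure lborel {0..1::real})"
  by (rule prob_space_uniform_measure) simp_all

lemma prob_space_exponential_product:
  "prob_space (\<Pi>\<^sub>M d\<in>(UNIV :: 'n::finite set). density lborel (exponential_density 1))"
  by (intro prob_space_PiM prob_space_std_exponential)

lemma prob_space_node_noise: "prob_space (node_noise :: (('n::finite \<Rightarrow> real) \<times> real) measure)"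
  unfolding node_noise_def
  by (rule prob_space_pair[OF prob_space_exponential_product prob_space_unit_uniform])

lemma AE_node_noise_uniform:
  "AE z in (node_noise :: (('n::finite \<Rightarrow> real) \<times> real) measure). 0 < snd z \<and> snd z \<le> 1"
proof -
  let ?E = "\<Pi>\<^sub>M d\<in>(UNIV :: 'n set). density lborel (exponential_density 1)"
  let ?U = "uniform_measure lborel {0..1::real}"
  interpret E: prob_space ?E by (rule prob_space_exponential_product)
  interpret U: prob_space ?U by (rule prob_space_unit_uniform)
  interpret P: pair_sigma_finite ?E ?U ..
  have "AE u in ?U. 0 < u \<and> u \<le> 1"
  proof (rule AE_uniform_measureI)
    show "AE u in lborel. u \<in> {0..1} \<longrightarrow> 0 < u \<and> u \<le> (1::real)"
      using AE_lborel_singleton[of "0::real"] by eventually_elim auto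
  qed simp
  then have "AE e in ?E. AE u in ?U. 0 < snd (e, u) \<and> snd (e, u) \<le> 1" by simp
  moreover have "snd \<in> borel_measurable (?E \<Otimes>\<^sub>M ?U)"
    using measurable_snd[of ?E ?U] by (simp cong: measurable_cong_sets)
  then have "{z \<in> space (?E \<Otimes>\<^sub>M ?U). 0 < snd z \<and> snd z \<le> 1} \<in> sets (?E \<Otimes>\<^sub>M ?U)"
    by measurable
  ultimately show ?thesis
    unfolding node_noise_def by (intro P.AE_pair_measure)
qed

lemma emeasure_exponential_greater:
  assumes "0 \<le> a"
  shows "emeasure (density lborel (exponential_density 1)) {a<..} = ennreal (exp (- a))"
proof -
  let ?E = "density lborel (exponential_density 1)"
  interpret prob_space ?E by (rule prob_space_std_exponential)
  have "distributed ?E lborel (\<lambda>x. x) (exponential_density 1)"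
    by (simp add: distributed_def distr_id2)
  from exponential_distributedD_gt[OF this assms]
  have "prob {a<..} = exp (- a)" by (simp add: greaterThan_def)
  then show ?thesis by (simp add: emeasure_eq_measure)
qed

lemma less_divide_rate_iff:
  assumes "r \<noteq> 0" "0 \<le> r"
  shows "ereal t < ereal (e / r) \<longleftrightarrow> e \<in> {t * r<..}"
  using assms by (simp add: pos_less_divide_eq)

text \<open>The event constrains each exponential variable separately and leaves the uniform one
  free, so it is a measurable rectangle; independence turns its probability into a product of
  exponential tails.\<close>

lemma ring_time_survival:
  fixes C :: "(real ^ 'n::finite) set"
  assumes t: "0 \<le> t" and pos: "\<And>d. 0 \<le> side_length d C"
  shows "{z \<in> space node_noise. ereal t < ring_time C z} \<in> sets node_noise"
    and "emeasure node_noise {z \<in> space node_noise. ereal t < ring_time C z}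
           = ennreal (exp (- t * (\<Sum>d\<in>UNIV. side_length d C)))"
proof -
  let ?D = "density lborel (exponential_density 1)"
  let ?E = "\<Pi>\<^sub>M d\<in>(UNIV :: 'n set). ?D"
  let ?U = "uniform_measure lborel {0..1::real}"
  \<comment> \<open>A zero side allows every value; its probability 1 equals
    \<open>exp (- t * 0)\<close>, so one formula covers both cases.\<close>
  define A where "A d = (if side_length d C = 0 then UNIV else {t * side_length d C<..})" for d
  interpret D: prob_space ?D by (rule prob_space_std_exponential)
  interpret U: prob_space ?U by (rule prob_space_unit_uniform)
  interpret product_sigma_finite "\<lambda>_::'n. ?D" ..
  have Am: "A d \<in> sets ?D" for d by (simp add: A_def)
  then have Em: "Pi\<^sub>E UNIV A \<in> sets ?E" by (intro sets_PiM_I_finite) auto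
  have "space ?E = UNIV" by (simp add: space_PiM)
  then have "space node_noise = (UNIV :: (('n \<Rightarrow> real) \<times> real) set)"
    by (simp add: node_noise_def space_pair_measure)
  moreover have "side_length d C = 0 \<or> ereal t < ereal (e / side_length d C) \<longleftrightarrow> e \<in> A d" for d e
    using less_divide_rate_iff[OF _ pos] by (simp add: A_def)
  ultimately have eq: "{z \<in> space node_noise. ereal t < ring_time C z} = Pi\<^sub>E UNIV A \<times> space ?U"
    by (simp only: less_ring_time_iff) (auto simp: PiE_iff)
  show "{z \<in> space node_noise. ereal t < ring_time C z} \<in> sets node_noise"
    unfolding eq unfolding node_noise_def using Em by (intro pair_measureI) auto
  have "emeasure ?D (A d) = ennreal (exp (- t * side_length d C))" for d
    using D.emeasure_space_1 emeasure_exponential_greater[of "t * side_length d C"] t pos[of d]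
    by (auto simp: A_def)
  then have "emeasure ?E (Pi\<^sub>E UNIV A) = (\<Prod>d\<in>UNIV. ennreal (exp (- t * side_length d C)))"
    using Am by (subst emeasure_PiM) auto
  also have "\<dots> = ennreal (exp (- t * (\<Sum>d\<in>UNIV. side_length d C)))"
    by (simp add: prod_ennreal exp_sum[symmetric] sum_distrib_left)
  finally show "emeasure node_noise {z \<in> space node_noise. ereal t < ring_time C z}
           = ennreal (exp (- t * (\<Sum>d\<in>UNIV. side_length d C)))"
    unfolding eq unfolding node_noise_def
    using Em U.emeasure_space_1 by (subst U.emeasure_pair_measure_Times) auto
qed

text \<open>Up to a null set the event depends on the noise at the root alone, whose law is
  \<open>node_noise\<close>. Its measurability is assumed here, as it formally involves the cells of
  all nodes.\<close>

lemma emeasure_noise_same_cell_bounding_box: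
  fixes x y :: "real ^ 'n::finite"
  assumes t: "0 \<le> t"
    and m: "{\<omega> \<in> space noise_space. same_cell (box_mondrian (bounding_box x y) t \<omega>) x y}
              \<in> sets noise_space"
  shows "emeasure noise_space
             {\<omega> \<in> space noise_space. same_cell (box_mondrian (bounding_box x y) t \<omega>) x y}
           = ennreal (laplace_kernel t x y)"
proof -
  let ?X = "bounding_box x y"
  let ?S = "{z \<in> space node_noise. ereal t < ring_time ?X z}"
  have pos: "0 \<le> side_length d ?X" for d by (simp add: side_length_bounding_box)
  note S = ring_time_survival[where C = ?X, OF t pos]
  have root: "(\<lambda>\<omega>. \<omega> []) \<in> measurable (noise_space :: 'n noise measure) node_noise"
    unfolding noise_space_def by simp
  have dist: "distr noise_space node_noise (\<lambda>\<omega>. \<omega> []) = (node_noise :: (('n \<Rightarrow> real) \<times> real) measure)"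
    unfolding noise_space_def by (rule distr_PiM_component) (auto intro: prob_space_node_noise)
  have "AE \<omega> in (noise_space :: 'n noise measure). 0 < snd (\<omega> []) \<and> snd (\<omega> []) \<le> 1"
    unfolding noise_space_def
    by (rule AE_PiM_component[OF prob_space_node_noise UNIV_I AE_node_noise_uniform])
  then have "emeasure noise_space {\<omega> \<in> space noise_space. same_cell (box_mondrian ?X t \<omega>) x y}
      = emeasure noise_space ((\<lambda>\<omega>. \<omega> []) -` ?S \<inter> space noise_space)"
  proof (intro emeasure_eq_AE m measurable_sets[OF root] S(1), eventually_elim)
    case (elim \<omega>)
    then show ?case
      using same_cell_bounding_box_iff[of \<omega> t x y] t measurable_space[OF root, of \<omega>] by auto
  qed
  also have "\<dots> = emeasure (distr noise_space node_noise (\<lambda>\<omega>. \<omega> [])) ?S"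
    by (simp add: emeasure_distr root S(1))
  also have "\<dots> = ennreal (laplace_kernel t x y)"
    unfolding dist S(2) by (simp add: laplace_kernel_def l1_norm_def side_length_bounding_box)
  finally show ?thesis .
qed

section \<open>Transfer from the noise model to an arbitrary process\<close>

lemma same_cell_event_in_path_space:
  assumes "x \<in> X" "y \<in> X" "0 \<le> t"
  shows "{f \<in> space (path_space X). same_cell (f t) x y} \<in> sets (path_space X)"
proof -
  have "{P. same_cell P x y} \<in> sets (partition_space X)"
    unfolding partition_space_def using assms by (subst sets_measure_of) auto
  moreover have "(\<lambda>f. f t) \<in> measurable (path_space X) (partition_space X)"
    unfolding path_space_def using assms(3) by (intro measurable_component_singleton) simp
  ultimately have "(\<lambda>f. f t) -` {P. same_cell P x y} \<inter> space (path_space X) \<in> sets (path_space X)"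
    by (rule measurable_sets[rotated])
  then show ?thesis by (simp add: vimage_def Int_def conj_commute)
qed

lemma trajectory_in_path_space: "trajectory Y \<omega> \<in> space (path_space X)"
  by (auto simp: trajectory_def path_space_def partition_space_def space_PiM space_measure_of_conv)

lemma trajectory_nonneg [simp]: "0 \<le> t \<Longrightarrow> trajectory Y \<omega> t = Y t \<omega>"
  by (simp add: trajectory_def)

text \<open>Both sides are the mass of one event in path space under the common law of the
  trajectories.\<close>

lemma emeasure_same_cell_eq_noise:
  fixes X :: "(real ^ 'n::finite) set"
  assumes Y: "mondrian_process_on_box M Y X"
    and xy: "x \<in> X" "y \<in> X" and t: "0 \<le> t"
  shows "{\<omega> \<in> space M. same_cell (Y t \<omega>) x y} \<in> sets M"
    and "{\<omega> \<in> space noise_space. same_cell (box_mondrian X t \<omega>) x y} \<in> sets noise_space"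
    and "emeasure M {\<omega> \<in> space M. same_cell (Y t \<omega>) x y}
           = emeasure noise_space {\<omega> \<in> space noise_space. same_cell (box_mondrian X t \<omega>) x y}"
proof -
  let ?P = "path_space X"
  let ?A = "{f \<in> space ?P. same_cell (f t) x y}"
  interpret M: prob_space M using Y by (simp add: mondrian_process_on_box_def)
  have mY: "trajectory Y \<in> measurable M ?P"
    and eq: "distr M ?P (trajectory Y) = distr noise_space ?P (trajectory (box_mondrian X))"
    using Y by (auto simp: mondrian_process_on_box_def)
  \<comment> \<open>Measurability of the noise model is not proved from its construction: its image
    equals the law of \<open>Y\<close>, which is a probability measure, and this forces it.\<close>
  have mB: "trajectory (box_mondrian X) \<in> measurable noise_space ?P"
    using M.prob_space_distr[OF mY] unfolding eq
    by (rule measurable_if_prob_space_distr) (auto intro: trajectory_in_path_space)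
  note A = same_cell_event_in_path_space[OF xy t]
  have 1: "trajectory Y -` ?A \<inter> space M = {\<omega> \<in> space M. same_cell (Y t \<omega>) x y}"
    using t by (auto simp: trajectory_in_path_space)
  have 2: "trajectory (box_mondrian X) -` ?A \<inter> space noise_space
      = {\<omega> \<in> space noise_space. same_cell (box_mondrian X t \<omega>) x y}"
    using t by (auto simp: trajectory_in_path_space)
  show "{\<omega> \<in> space M. same_cell (Y t \<omega>) x y} \<in> sets M"
    using measurable_sets[OF mY A] unfolding 1 .
  show "{\<omega> \<in> space noise_space. same_cell (box_mondrian X t \<omega>) x y} \<in> sets noise_space"
    using measurable_sets[OF mB A] unfolding 2 .
  show "emeasure M {\<omega> \<in> space M. same_cell (Y t \<omega>) x y}
           = emeasure noise_space {\<omega> \<in> space noise_space. same_cell (box_mondrian X t \<omega>) x y}"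
    using arg_cong[OF eq, of "\<lambda>N. emeasure N ?A"]
    unfolding emeasure_distr[OF mY A] emeasure_distr[OF mB A] 1 2 .
qed

text \<open>A common cell still contains both points after intersection with \<open>X\<close>, so it
  is not among the empty sets that are removed.\<close>

lemma same_cell_restrict_partition:
  assumes "x \<in> X" "y \<in> X"
  shows "same_cell (restrict_partition X P) x y \<longleftrightarrow> same_cell P x y"
proof
  show "same_cell P x y" if "same_cell (restrict_partition X P) x y"
    using that unfolding same_cell_def restrict_partition_def by blast
next
  assume "same_cell P x y"
  then obtain C where "C \<in> P" "x \<in> C \<inter> X" "y \<in> C \<inter> X"
    using assms by (auto simp: same_cell_def)
  moreover from this have "C \<inter> X \<in> restrict_partition X P"
    unfolding restrict_partition_def by blast
  ultimately show "same_cell (restrict_partition X P) x y"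
    unfolding same_cell_def by (intro bexI[of _ "C \<inter> X"] conjI)
qed

theorem proposition1:
  fixes M :: "'w measure"
    and Y :: "real \<Rightarrow> 'w \<Rightarrow> (real ^ 'n::finite) set set"
    and lam :: real
    and x x' :: "real ^ 'n"
  assumes "mondrian_process M Y"
    and "lam \<ge> 0"
  shows "mondrian_kernel_inf M Y lam x x' = laplace_kernel lam x x' \<and>
         laplace_kernel lam x x' = exp (- lam * (\<Sum>d\<in>UNIV. \<bar>x $ d - x' $ d\<bar>))"
proof
  let ?X = "bounding_box x x'"
  let ?S = "{\<omega> \<in> space M. same_cell (Y lam \<omega>) x x'}"
  have "mondrian_process_on_box M (\<lambda>t \<omega>. restrict_partition ?X (Y t \<omega>)) ?X"
    using assms(1) axis_box_bounding_box[of x x'] unfolding mondrian_process_def by blast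
  note E = emeasure_same_cell_eq_noise[OF this mem_bounding_box assms(2),
      unfolded same_cell_restrict_partition[OF mem_bounding_box]]
  have "emeasure M ?S = ennreal (laplace_kernel lam x x')"
    using E(3) emeasure_noise_same_cell_bounding_box[OF assms(2) E(2)] by simp
  then have "measure M ?S = laplace_kernel lam x x'"
    by (simp add: measure_def laplace_kernel_def)
  \<comment> \<open>The two integrands need to agree only on \<open>space M\<close>; the kernel thus
    becomes the probability of \<open>?S\<close>.\<close>
  moreover have "mondrian_kernel_inf M Y lam x x' = (\<integral>\<omega>. indicat_real ?S \<omega> \<partial>M)"
    unfolding mondrian_kernel_inf_def mondrian_kernel_1_def
    by (rule Bochner_Integration.integral_cong) (auto simp: indicator_def)
  ultimately show "mondrian_kernel_inf M Y lam x x' = laplace_kernel lam x x'"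
    using E(1) by simp
  show "laplace_kernel lam x x' = exp (- lam * (\<Sum>d\<in>UNIV. \<bar>x $ d - x' $ d\<bar>))"
    by (simp add: laplace_kernel_def l1_norm_def)
qed

end
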